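(* Let $E$ be a real vector space, let $f\colon E\to\mathbb{R}$ be convex, and let $B$ be a nonempty subset of $E\times\mathbb{R}$. Suppose that $$\inf_{(b,\beta)\in B}\big[f(b)+\beta\big]\in\mathbb{R},$$ and that for all $(b_1,\beta_1),(b_2,\beta_2)\in B$ there exists $(b,\beta)\in B$ such that, for all real $\rho\ge 0$, $$f\big(\rho\big[b-\tfrac12 b_1-\tfrac12 b_2\big]\big)+\rho\big[\beta-\tfrac12\beta_1-\tfrac12\beta_2\big]\le f(0).$$ Then there exists an affine map $A\colon E\to\mathbb{R}$ such that $A\le f$ on $E$ and $$\inf_{(b,\beta)\in B}\big[A(b)+\beta\big]=\inf_{(b,\beta)\in B}\big[f(b)+\beta\big].$$
   Context: All vector spaces are real. "Convex" and "affine" have their usual senses; in particular an affine map $A\colon E\to\mathbb{R}$ is a linear functional plus a real constant. $A\le f$ on $E$ means $A(x)\le f(x)$ for all $x\in E$. *)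

theory Defs
  imports "HOL-Analysis.Analysis"
begin

definition affine_functional :: "('a::real_vector \<Rightarrow> real) \<Rightarrow> bool" where
  "affine_functional A \<longleftrightarrow> (\<exists>L c. linear L \<and> A = (\<lambda>x. L x + c))"

end

theory Submission
  imports Defs
begin

text \<open>
  The idea is to encode the family \<open>B\<close> in one function,
  \<open>g x = (INF (b, \<beta>)\<in>B. f (x + b) + \<beta>)\<close>, whose value at \<open>0\<close> is the given infimum \<open>\<alpha>\<close>.
  A linear \<open>L\<close> with \<open>\<alpha> + L x \<le> g x\<close> for all \<open>x\<close> says, after the substitution \<open>y = x + b\<close>, that
  \<open>\<alpha> - L b - \<beta> \<le> f y - L y\<close> for all \<open>y\<close> and all \<open>(b, \<beta>) \<in> B\<close>. Hence the affine map
  \<open>L + (INF y. f y - L y)\<close>, which lies below \<open>f\<close> by construction, has \<open>\<alpha>\<close> as a lower bound of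
  \<open>L b + (INF y. f y - L y) + \<beta>\<close> over \<open>(b, \<beta>) \<in> B\<close>. So the theorem asks for a subgradient of \<open>g\<close> at \<open>0\<close>.

  The hypothesis on \<open>B\<close> is that each midpoint of two points of \<open>B\<close> differs from some point of \<open>B\<close>
  by a vector \<open>(v, w)\<close> along which \<open>f (\<rho> v) + \<rho> w\<close> stays below \<open>f 0\<close>. For a convex \<open>f\<close> such a
  vector is a recession direction at every point: \<open>f (x + v) + w \<le> f x\<close>
  (lemma \<open>convex_recession_shift\<close>). Replacing a midpoint by that point of \<open>B\<close> therefore does not
  increase \<open>f (x + b) + \<beta>\<close>, which makes \<open>g\<close> midpoint convex and, as \<open>g 0 > -\<infinity>\<close>,
  finite everywhere.

  Midpoint convexity alone yields an additive \<open>L \<le> g - g 0\<close> (lemma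
  \<open>midconvex_additive_minorant\<close>): by Zorn's lemma there is a minimal midpoint convex function
  below \<open>g - g 0\<close> that vanishes at \<open>0\<close>, and minimality forces additivity. Finally \<open>g\<close> lies below a
  translate of the convex function \<open>f\<close>, up to a constant, so \<open>L\<close> is bounded above on segments and
  this makes it linear (lemma \<open>additive_below_convex_imp_linear\<close>).
\<close>

section \<open>Convex functions along lines\<close>

text \<open>
  Along the ray \<open>t \<mapsto> x + t v\<close>, the function \<open>f (x + t v) + t w\<close> is convex and bounded above:
  \<open>x + t v\<close> is the midpoint of \<open>2 x\<close> and \<open>2 t v\<close>. A convex function that is bounded above on a
  half-line cannot increase there.
\<close>
lemma convex_recession_shift:
  fixes f :: "'a::real_vector \<Rightarrow> real"
  assumes cvx: "convex_on UNIV f"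
    and rec: "\<And>\<rho>. \<rho> \<ge> 0 \<Longrightarrow> f (\<rho> *\<^sub>R v) + \<rho> * w \<le> f 0"
  shows "f (x + v) + w \<le> f x"
proof -
  define M where "M = (f (2 *\<^sub>R x) + f 0) / 2 - f x"
  have step: "f (x + v) + w - f x \<le> M * inverse (real (Suc n))" for n
  proof -
    define N where "N = real (Suc n)"
    have N: "N \<ge> 1" "N > 0" by (simp_all add: N_def)
    have "f ((1 - 1/2) *\<^sub>R (2 *\<^sub>R x) + (1/2) *\<^sub>R ((2 * N) *\<^sub>R v))
        \<le> (1 - 1/2) * f (2 *\<^sub>R x) + (1/2) * f ((2 * N) *\<^sub>R v)"
      by (intro convex_onD[OF cvx]) auto
    moreover have "f ((2 * N) *\<^sub>R v) + (2 * N) * w \<le> f 0"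
      using N by (intro rec) auto
    ultimately have far: "f (x + N *\<^sub>R v) + N * w - f x \<le> M"
      by (simp add: M_def field_simps)
    have "f ((1 - 1/N) *\<^sub>R x + (1/N) *\<^sub>R (x + N *\<^sub>R v))
        \<le> (1 - 1/N) * f x + (1/N) * f (x + N *\<^sub>R v)"
      using N by (intro convex_onD[OF cvx]) auto
    moreover have "(1 - 1/N) *\<^sub>R x + (1/N) *\<^sub>R (x + N *\<^sub>R v) = x + v"
      using N by (simp add: algebra_simps)
    ultimately have "N * (f (x + v) + w - f x) \<le> f (x + N *\<^sub>R v) + N * w - f x"
      using N by (simp add: field_simps)
    with far have "N * (f (x + v) + w - f x) \<le> M" by linarith
    then have "f (x + v) + w - f x \<le> M / N"
      using N by (simp add: pos_le_divide_eq mult.commute)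
    then show ?thesis by (simp add: N_def divide_inverse)
  qed
  have "(\<lambda>n. M * inverse (real (Suc n))) \<longlonglongrightarrow> M * 0"
    by (intro tendsto_mult tendsto_const LIMSEQ_inverse_real_of_nat)
  then have "f (x + v) + w - f x \<le> M * 0"
    by (rule LIMSEQ_le_const) (use step in auto)
  then show ?thesis by simp
qed

text \<open>
  The defect \<open>\<phi> t = L (t x) - t L x\<close> is additive and vanishes at \<open>1\<close>, so it has period \<open>1\<close>;
  convexity bounds it above on \<open>[0, 1]\<close>, hence everywhere, and an additive function that is bounded
  above vanishes.
\<close>
lemma additive_below_convex_imp_linear:
  fixes F L :: "'a::real_vector \<Rightarrow> real"
  assumes cvx: "convex_on UNIV F"
    and add: "\<And>x y. L (x + y) = L x + L y"
    and le: "\<And>x. L x \<le> F x"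
  shows "linear L"
proof (rule linearI)
  fix t :: real and x :: 'a
  define \<phi> where "\<phi> t = L (t *\<^sub>R x) - t * L x" for t
  have phi_add: "\<phi> (s + t) = \<phi> s + \<phi> t" for s t
    by (simp add: \<phi>_def scaleR_add_left add algebra_simps)
  have phi_0: "\<phi> 0 = 0" using phi_add[of 0 0] by simp
  have phi_minus: "\<phi> (- t) = - \<phi> t" for t
    using phi_add[of t "- t"] phi_0 by simp
  have phi_nat_mult: "\<phi> (real n * t) = real n * \<phi> t" for n t
    by (induction n) (simp_all add: phi_0 phi_add algebra_simps)
  have phi_nat: "\<phi> (real n) = 0" for n
    using phi_nat_mult[of n 1] by (simp add: \<phi>_def)
  have phi_int: "\<phi> (of_int k) = 0" for k
  proof (cases "k \<ge> 0")
    case True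
    then show ?thesis using phi_nat[of "nat k"] by simp
  next
    case False
    then show ?thesis using phi_nat[of "nat (- k)"] phi_minus[of "of_int k"] by simp
  qed
  define K where "K = \<bar>F 0\<bar> + \<bar>F x\<bar> + \<bar>L x\<bar>"
  have bound: "\<phi> r \<le> K" for r
  proof -
    define s where "s = frac r"
    have s: "0 \<le> s" "s \<le> 1" by (simp_all add: s_def frac_lt_1 less_imp_le)
    have "\<phi> r = \<phi> s"
      using phi_add[of "of_int \<lfloor>r\<rfloor>" s] phi_int by (simp add: s_def frac_def)
    also have "\<phi> s \<le> F (s *\<^sub>R x) - s * L x"
      using le by (simp add: \<phi>_def)
    also have "F (s *\<^sub>R x) \<le> (1 - s) * F 0 + s * F x"
      using convex_onD[OF cvx s, of 0 x] by simp
    also have "(1 - s) * F 0 + s * F x - s * L x \<le> K"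
    proof -
      have c: "c * y \<le> \<bar>y\<bar>" if "0 \<le> c" "c \<le> 1" for c y :: real
      proof -
        have "c * y \<le> c * \<bar>y\<bar>" using that by (intro mult_left_mono) auto
        also have "\<dots> \<le> 1 * \<bar>y\<bar>" using that by (intro mult_right_mono) auto
        finally show ?thesis by simp
      qed
      show ?thesis
        using c[of "1 - s" "F 0"] c[of s "F x"] c[of s "- L x"] s by (simp add: K_def)
    qed
    finally show ?thesis by simp
  qed
  have nonpos: "\<phi> t \<le> 0" for t
  proof (rule ccontr)
    assume "\<not> \<phi> t \<le> 0"
    then obtain n where "K < real n * \<phi> t"
      using reals_Archimedean3[of "\<phi> t"] by auto
    then show False using bound[of "real n * t"] phi_nat_mult[of n t] by simp
  qed
  show "L (t *\<^sub>R x) = t *\<^sub>R L x"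
    using nonpos[of t] nonpos[of "- t"] phi_minus[of t] by (simp add: \<phi>_def)
qed (rule add)

section \<open>Additive minorants of midpoint convex functions\<close>

definition midconvex :: "('a::real_vector \<Rightarrow> real) \<Rightarrow> bool" where
  "midconvex h \<longleftrightarrow> (\<forall>x y. h ((1/2) *\<^sub>R (x + y)) \<le> (h x + h y) / 2)"

definition midconvex_minorants :: "('a::real_vector \<Rightarrow> real) \<Rightarrow> ('a \<Rightarrow> real) set" where
  "midconvex_minorants g = {h. midconvex h \<and> h 0 = 0 \<and> h \<le> g}"

lemma midconvex_minorants_lower_bound:
  assumes "h \<in> midconvex_minorants g"
  shows "- g (- x) \<le> h x"
proof -
  have "h ((1/2) *\<^sub>R (x + - x)) \<le> (h x + h (- x)) / 2"
    using assms unfolding midconvex_minorants_def midconvex_def by blast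
  moreover have "h 0 = 0" "h (- x) \<le> g (- x)"
    using assms by (auto simp: midconvex_minorants_def le_fun_def)
  ultimately show ?thesis by simp
qed

text \<open>
  Midpoint convexity compares values at two points, and in a chain the members chosen for the two
  points can be replaced by the smaller one. The infimum is finite because midpoint convexity with
  \<open>h 0 = 0\<close> bounds every member from below by \<open>- g (- x)\<close>.
\<close>
lemma chain_has_lower_bound_in_midconvex_minorants:
  fixes g :: "'a::real_vector \<Rightarrow> real"
  assumes sub: "C \<subseteq> midconvex_minorants g" and ne: "C \<noteq> {}"
    and chain: "\<And>h k. h \<in> C \<Longrightarrow> k \<in> C \<Longrightarrow> h \<le> k \<or> k \<le> h"
  obtains u where "u \<in> midconvex_minorants g" "\<And>h. h \<in> C \<Longrightarrow> u \<le> h"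
proof -
  define u where "u x = (INF h\<in>C. h x)" for x
  have bdd: "bdd_below ((\<lambda>h. h x) ` C)" for x
    using midconvex_minorants_lower_bound sub by (intro bdd_belowI2[of _ "- g (- x)"]) blast
  have lower: "u x \<le> h x" if "h \<in> C" for h x
    unfolding u_def using bdd that by (rule cINF_lower)
  have "midconvex u"
    unfolding midconvex_def
  proof (intro allI)
    fix x y
    let ?m = "u ((1/2) *\<^sub>R (x + y))"
    have *: "2 * ?m \<le> h x + k y" if hk: "h \<in> C" "k \<in> C" for h k
    proof -
      obtain l where l: "l \<in> C" "l \<le> h" "l \<le> k"
        using chain[OF hk] hk by blast
      have "?m \<le> l ((1/2) *\<^sub>R (x + y))" using l lower by blast
      also have "\<dots> \<le> (l x + l y) / 2"
        using l sub by (auto simp: midconvex_minorants_def midconvex_def)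
      finally show ?thesis using l by (auto simp: le_fun_def) (smt (verit))
    qed
    have "2 * ?m - u y \<le> u x"
      unfolding u_def[of x]
    proof (rule cINF_greatest[OF ne])
      fix h assume h: "h \<in> C"
      have "2 * ?m - h x \<le> u y"
        unfolding u_def[of y] using *[OF h] by (intro cINF_greatest[OF ne]) (simp add: algebra_simps)
      then show "2 * ?m - u y \<le> h x" by simp
    qed
    then show "?m \<le> (u x + u y) / 2" by simp
  qed
  moreover have "u 0 = 0"
  proof -
    have "(\<lambda>h. h 0) ` C = {0}"
      using sub ne by (force simp: midconvex_minorants_def)
    then show ?thesis by (simp add: u_def)
  qed
  moreover have "u \<le> g"
  proof -
    obtain h where "h \<in> C" using ne by blast
    moreover from this have "h \<le> g" using sub by (auto simp: midconvex_minorants_def)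
    ultimately show ?thesis using lower by (meson le_funI order_trans)
  qed
  ultimately have "u \<in> midconvex_minorants g" by (simp add: midconvex_minorants_def)
  then show thesis using lower that by (auto simp: le_fun_def)
qed

text \<open>
  Each rescaling or translate that stays below \<open>h\<close> must coincide with \<open>h\<close>. The function
  \<open>x \<mapsto> 2 h (x / 2)\<close> gives \<open>h (2 x) = 2 h x\<close>, so \<open>h\<close> is subadditive. Then the translates
  \<open>x \<mapsto> h (x + 2^n a) - 2^n h a\<close> decrease with \<open>n\<close> and vanish at \<open>0\<close>; a
  midpoint convex minorant of all of them that vanishes at \<open>0\<close> equals \<open>h\<close>, and \<open>n = 0\<close> at the point \<open>- a\<close> gives \<open>h (- a) \<le> - h a\<close>.
  The powers of two are used because \<open>h (2^n a) = 2^n h a\<close> is available for them.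
\<close>
lemma minimal_midconvex_additive:
  fixes h :: "'a::real_vector \<Rightarrow> real"
  assumes mid: "midconvex h" and h0: "h 0 = 0"
    and minimal: "\<And>k. k \<in> midconvex_minorants h \<Longrightarrow> k = h"
  shows "h (x + y) = h x + h y"
proof -
  have midD: "h ((1/2) *\<^sub>R (x + y)) \<le> (h x + h y) / 2" for x y
    using mid by (simp add: midconvex_def)
  have "(\<lambda>x. 2 * h ((1/2) *\<^sub>R x)) \<in> midconvex_minorants h"
  proof -
    have "2 * h ((1/2) *\<^sub>R x) \<le> h x" for x
      using midD[of x 0] h0 by simp
    moreover have "midconvex (\<lambda>x. 2 * h ((1/2) *\<^sub>R x))"
      unfolding midconvex_def
    proof (intro allI)
      fix x y
      show "2 * h ((1/2) *\<^sub>R ((1/2) *\<^sub>R (x + y)))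
          \<le> (2 * h ((1/2) *\<^sub>R x) + 2 * h ((1/2) *\<^sub>R y)) / 2"
        using midD[of "(1/2) *\<^sub>R x" "(1/2) *\<^sub>R y"] by (simp add: scaleR_add_right)
    qed
    ultimately show ?thesis by (simp add: midconvex_minorants_def le_fun_def h0)
  qed
  from minimal[OF this] have half: "2 * h ((1/2) *\<^sub>R x) = h x" for x by metis
  have subadd: "h (x + y) \<le> h x + h y" for x y
    using midD[of x y] half[of "x + y"] by simp
  have pow: "h (2 ^ n *\<^sub>R a) = 2 ^ n * h a" for n a
  proof (induction n)
    case (Suc n)
    then show ?case using half[of "2 ^ Suc n *\<^sub>R a"] by simp
  qed simp
  have neg: "h (- a) = - h a" for a
  proof -
    define k where "k n x = h (x + 2 ^ n *\<^sub>R a) - 2 ^ n * h a" for n :: nat and x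
    have dec1: "k (Suc n) \<le> k n" for n
    proof (rule le_funI)
      fix x
      have "x + 2 ^ Suc n *\<^sub>R a = (x + 2 ^ n *\<^sub>R a) + 2 ^ n *\<^sub>R a"
        by (simp add: add.assoc flip: scaleR_add_left)
      then show "k (Suc n) x \<le> k n x"
        using subadd[of "x + 2 ^ n *\<^sub>R a" "2 ^ n *\<^sub>R a"] pow[of n a]
        by (simp add: k_def add.assoc mult.commute[of _ "h a"])
    qed
    have dec: "k n \<le> k m" if "m \<le> n" for m n
      using lift_Suc_antimono_le[of k, OF dec1 that] .
    have "k n \<in> midconvex_minorants h" for n
    proof -
      have "midconvex (k n)"
        unfolding midconvex_def
      proof (intro allI)
        fix x y
        have "(1/2) *\<^sub>R ((x + 2 ^ n *\<^sub>R a) + (y + 2 ^ n *\<^sub>R a))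
            = (1/2) *\<^sub>R (x + y) + 2 ^ n *\<^sub>R a"
          by (simp add: algebra_simps flip: scaleR_add_left)
        then show "k n ((1/2) *\<^sub>R (x + y)) \<le> (k n x + k n y) / 2"
          using midD[of "x + 2 ^ n *\<^sub>R a" "y + 2 ^ n *\<^sub>R a"] by (simp add: k_def field_simps)
      qed
      moreover have "k n 0 = 0" by (simp add: k_def pow)
      moreover have "k n x \<le> h x" for x
        using subadd[of x "2 ^ n *\<^sub>R a"] by (simp add: k_def pow)
      ultimately show ?thesis by (simp add: midconvex_minorants_def le_fun_def)
    qed
    then have sub: "range k \<subseteq> midconvex_minorants h" by blast
    have chain: "p \<le> q \<or> q \<le> p" if "p \<in> range k" "q \<in> range k" for p q
      using that dec nat_le_linear by blast
    obtain u where u: "u \<in> midconvex_minorants h" "\<And>p. p \<in> range k \<Longrightarrow> u \<le> p"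
      by (rule chain_has_lower_bound_in_midconvex_minorants[OF sub]) (use chain in blast)+
    have "h \<le> k 0" using u minimal by blast
    then have "h (- a) \<le> k 0 (- a)" by (rule le_funD)
    then have "h (- a) \<le> - h a" by (simp add: k_def h0)
    moreover have "0 \<le> h a + h (- a)" using subadd[of a "- a"] h0 by simp
    ultimately show ?thesis by simp
  qed
  have "h x \<le> h (x + y) + h (- y)" using subadd[of "x + y" "- y"] by simp
  with subadd[of x y] neg[of y] show ?thesis by simp
qed

lemma midconvex_additive_minorant:
  fixes g :: "'a::real_vector \<Rightarrow> real"
  assumes "midconvex g" "g 0 = 0"
  obtains L where "\<And>x y. L (x + y) = L x + L y" "\<And>x. L x \<le> g x"
proof -
  let ?M = "midconvex_minorants g"
  let ?P = "\<lambda>h k :: 'a \<Rightarrow> real. k \<le> h"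
  have g: "g \<in> ?M" using assms by (simp add: midconvex_minorants_def)
  have "\<exists>m\<in>?M. \<forall>k\<in>?M. k \<le> m \<longrightarrow> k = m"
  proof (rule predicate_Zorn)
    show "partial_order_on ?M (relation_of ?P ?M)"
      by (rule partial_order_on_relation_ofI) auto
  next
    fix C assume C: "C \<in> Chains (relation_of ?P ?M)"
    show "\<exists>u\<in>?M. \<forall>h\<in>C. u \<le> h"
    proof (cases "C = {}")
      case True
      with g show ?thesis by blast
    next
      case False
      have sub: "C \<subseteq> ?M" using C by (auto simp: Chains_def relation_of_def)
      have "h \<le> k \<or> k \<le> h" if "h \<in> C" "k \<in> C" for h k
        using C that by (auto simp: Chains_def relation_of_def)
      then show ?thesis
        using chain_has_lower_bound_in_midconvex_minorants[OF sub False] by metis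
    qed
  qed
  then obtain h where h: "h \<in> ?M" and min: "\<And>k. k \<in> ?M \<Longrightarrow> k \<le> h \<Longrightarrow> k = h" by blast
  have hh: "midconvex h" "h 0 = 0" "h \<le> g" using h by (auto simp: midconvex_minorants_def)
  have "k = h" if "k \<in> midconvex_minorants h" for k
    using that hh(3) by (intro min) (auto simp: midconvex_minorants_def)
  then have "h (x + y) = h x + h y" for x y
    by (rule minimal_midconvex_additive[OF hh(1,2)])
  with hh(3) show thesis using that by (auto simp: le_fun_def)
qed

section \<open>Affine minorants preserving an infimum\<close>

theorem theorem3p5:
  fixes f :: "'a::real_vector \<Rightarrow> real"
    and B :: "('a \<times> real) set"
  assumes "convex_on UNIV f"
    and "B \<noteq> {}"
    and "\<bar>INF (b, \<beta>)\<in>B. ereal (f b + \<beta>)\<bar> \<noteq> \<infinity>"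
    and "\<forall>(b1, \<beta>1)\<in>B. \<forall>(b2, \<beta>2)\<in>B. \<exists>(b, \<beta>)\<in>B. \<forall>\<rho>::real. \<rho> \<ge> 0 \<longrightarrow>
           f (\<rho> *\<^sub>R (b - (1/2) *\<^sub>R b1 - (1/2) *\<^sub>R b2))
             + \<rho> * (\<beta> - (1/2) * \<beta>1 - (1/2) * \<beta>2) \<le> f 0"
  shows "\<exists>A. affine_functional A \<and> (\<forall>x. A x \<le> f x) \<and>
           (INF (b, \<beta>)\<in>B. ereal (A b + \<beta>)) = (INF (b, \<beta>)\<in>B. ereal (f b + \<beta>))"
proof -
  note cvx = assms(1)
  obtain \<alpha> where \<alpha>: "(INF (b, \<beta>)\<in>B. ereal (f b + \<beta>)) = ereal \<alpha>"
    using assms(3) by (metis ereal_real')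
  have \<alpha>_le: "\<alpha> \<le> f b + \<beta>" if "(b, \<beta>) \<in> B" for b \<beta>
    using INF_lower[OF that, of "\<lambda>(b, \<beta>). ereal (f b + \<beta>)"] \<alpha> by simp
  obtain b0 \<beta>0 where B0: "(b0, \<beta>0) \<in> B" using assms(2) by auto
  have replace: "\<exists>b \<beta>. (b, \<beta>) \<in> B \<and> f ((1/2) *\<^sub>R (x1 + x2) + b) + \<beta>
      \<le> ((f (x1 + b1) + \<beta>1) + (f (x2 + b2) + \<beta>2)) / 2"
    if in_B: "(b1, \<beta>1) \<in> B" "(b2, \<beta>2) \<in> B" for b1 \<beta>1 b2 \<beta>2 x1 x2
  proof -
    obtain b \<beta> where b: "(b, \<beta>) \<in> B"
      and rec: "\<And>\<rho>. \<rho> \<ge> 0 \<Longrightarrow> f (\<rho> *\<^sub>R (b - (1/2) *\<^sub>R b1 - (1/2) *\<^sub>R b2))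
             + \<rho> * (\<beta> - (1/2) * \<beta>1 - (1/2) * \<beta>2) \<le> f 0"
      using assms(4) in_B by fast
    let ?m = "(1 - 1/2) *\<^sub>R (x1 + b1) + (1/2) *\<^sub>R (x2 + b2)"
    have "?m + (b - (1/2) *\<^sub>R b1 - (1/2) *\<^sub>R b2) = (1/2) *\<^sub>R (x1 + x2) + b"
      by (simp add: algebra_simps)
    then have "f ((1/2) *\<^sub>R (x1 + x2) + b) + (\<beta> - (1/2) * \<beta>1 - (1/2) * \<beta>2) \<le> f ?m"
      using convex_recession_shift[OF cvx rec, where x = ?m] by metis
    also have "\<dots> \<le> (1 - 1/2) * f (x1 + b1) + (1/2) * f (x2 + b2)"
      by (intro convex_onD[OF cvx]) auto
    finally show ?thesis using b by (intro exI[of _ b] exI[of _ \<beta>]) (simp add: field_simps)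
  qed

  define g where "g x = (INF (b, \<beta>)\<in>B. f (x + b) + \<beta>)" for x
  have bdd: "bdd_below ((\<lambda>(b, \<beta>). f (x + b) + \<beta>) ` B)" for x
  proof (rule bdd_belowI2)
    fix p assume "p \<in> B"
    then obtain b1 \<beta>1 where p: "p = (b1, \<beta>1)" "(b1, \<beta>1) \<in> B" by (cases p) auto
    \<comment> \<open>The midpoint of \<open>x\<close> and \<open>- x\<close> is \<open>0\<close>, where the values are bounded below by \<open>\<alpha>\<close>.\<close>
    obtain b \<beta> where "(b, \<beta>) \<in> B" "f ((1/2) *\<^sub>R (x + - x) + b) + \<beta>
        \<le> ((f (x + b1) + \<beta>1) + (f (- x + b0) + \<beta>0)) / 2"
      using replace[OF p(2) B0] by blast
    then show "2 * \<alpha> - (f (- x + b0) + \<beta>0) \<le> (case p of (b, \<beta>) \<Rightarrow> f (x + b) + \<beta>)"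
      using \<alpha>_le[of b \<beta>] p by simp
  qed
  have g_le: "g x \<le> f (x + b) + \<beta>" if "(b, \<beta>) \<in> B" for x b \<beta>
    using cINF_lower[OF bdd that, of x] by (simp add: g_def)
  have g_ge: "c \<le> g x" if "\<And>b \<beta>. (b, \<beta>) \<in> B \<Longrightarrow> c \<le> f (x + b) + \<beta>" for c x
    unfolding g_def using that by (intro cINF_greatest[OF assms(2)]) auto
  have "midconvex (\<lambda>x. g x - g 0)"
    unfolding midconvex_def
  proof (intro allI)
    fix x y
    let ?m = "g ((1/2) *\<^sub>R (x + y))"
    have *: "2 * ?m \<le> (f (x + b1) + \<beta>1) + (f (y + b2) + \<beta>2)"
      if in_B: "(b1, \<beta>1) \<in> B" "(b2, \<beta>2) \<in> B" for b1 \<beta>1 b2 \<beta>2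
    proof -
      obtain b \<beta> where "(b, \<beta>) \<in> B" "f ((1/2) *\<^sub>R (x + y) + b) + \<beta>
          \<le> ((f (x + b1) + \<beta>1) + (f (y + b2) + \<beta>2)) / 2"
        using replace[OF in_B] by blast
      with g_le[of b \<beta> "(1/2) *\<^sub>R (x + y)"] show ?thesis by simp
    qed
    have "2 * ?m - g y \<le> g x"
    proof (rule g_ge)
      fix b1 \<beta>1 assume b1: "(b1, \<beta>1) \<in> B"
      have "2 * ?m - (f (x + b1) + \<beta>1) \<le> g y"
        by (rule g_ge) (use *[OF b1] in \<open>simp add: algebra_simps\<close>)
      then show "2 * ?m - g y \<le> f (x + b1) + \<beta>1" by simp
    qed
    then show "?m - g 0 \<le> (g x - g 0 + (g y - g 0)) / 2" by (simp add: field_simps)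
  qed
  then obtain L where add: "\<And>x y. L (x + y) = L x + L y" and L_le: "\<And>x. L x \<le> g x - g 0"
    using midconvex_additive_minorant[of "\<lambda>x. g x - g 0"] by auto

  have "linear L"
  proof (rule additive_below_convex_imp_linear[OF _ add])
    show "convex_on UNIV (\<lambda>x. f (x + b0) + (\<beta>0 - g 0))"
    proof (rule convex_onI)
      fix t :: real and x y :: 'a
      assume t: "0 < t" "t < 1"
      have "f ((1 - t) *\<^sub>R (x + b0) + t *\<^sub>R (y + b0)) \<le> (1 - t) * f (x + b0) + t * f (y + b0)"
        using t by (intro convex_onD[OF cvx]) auto
      moreover have "(1 - t) *\<^sub>R (x + b0) + t *\<^sub>R (y + b0) = (1 - t) *\<^sub>R x + t *\<^sub>R y + b0"
        by (simp add: algebra_simps)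
      ultimately show "f ((1 - t) *\<^sub>R x + t *\<^sub>R y + b0) + (\<beta>0 - g 0)
          \<le> (1 - t) * (f (x + b0) + (\<beta>0 - g 0)) + t * (f (y + b0) + (\<beta>0 - g 0))"
        by (simp add: algebra_simps)
    qed simp
    show "L x \<le> f (x + b0) + (\<beta>0 - g 0)" for x
      using L_le[of x] g_le[OF B0, of x] by simp
  qed
  have "\<alpha> \<le> g 0" using \<alpha>_le by (intro g_ge) simp
  then have below: "\<alpha> - L b - \<beta> \<le> f y - L y" if "(b, \<beta>) \<in> B" for b \<beta> y
    using L_le[of "y - b"] g_le[OF that, of "y - b"] add[of "y - b" b] by simp

  define c where "c = (INF y. f y - L y)"
  have c_le: "c \<le> f y - L y" for y
    unfolding c_def using below[OF B0] by (intro cINF_lower bdd_belowI2) auto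
  have c_ge: "\<alpha> - L b - \<beta> \<le> c" if "(b, \<beta>) \<in> B" for b \<beta>
    unfolding c_def using below[OF that] by (intro cINF_greatest) auto
  define A where "A x = L x + c" for x
  have "affine_functional A"
    unfolding affine_functional_def A_def using \<open>linear L\<close> by blast
  moreover have A_le: "A x \<le> f x" for x using c_le[of x] by (simp add: A_def)
  moreover have "(INF (b, \<beta>)\<in>B. ereal (A b + \<beta>)) = (INF (b, \<beta>)\<in>B. ereal (f b + \<beta>))"
  proof (rule antisym)
    show "(INF (b, \<beta>)\<in>B. ereal (A b + \<beta>)) \<le> (INF (b, \<beta>)\<in>B. ereal (f b + \<beta>))"
      using A_le by (intro INF_mono) (auto intro!: bexI)
    show "(INF (b, \<beta>)\<in>B. ereal (f b + \<beta>)) \<le> (INF (b, \<beta>)\<in>B. ereal (A b + \<beta>))"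
      unfolding \<alpha>
    proof (rule INF_greatest)
      fix p assume "p \<in> B"
      then show "ereal \<alpha> \<le> (case p of (b, \<beta>) \<Rightarrow> ereal (A b + \<beta>))"
        using c_ge[of "fst p" "snd p"] by (cases p) (simp add: A_def)
    qed
  qed
  ultimately show ?thesis by blast
qed

end
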